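(* Let $n, k \geq 1$ be integers and let $\mathcal{V}$ be an operator system in $M_n(\mathbb{C})$ of dimension at least $16k^8n$. Then $\mathcal{V}$ has a quantum $k$-clique.
   Context: An operator system in $M_n(\mathbb{C})$ is a complex linear subspace $\mathcal{V} \subseteq M_n(\mathbb{C})$ containing the identity matrix $I_n$ and such that $A \in \mathcal{V}$ implies $A^* \in \mathcal{V}$, where $A^*$ is the Hermitian (conjugate) transpose. An orthogonal projection is a matrix $P \in M_n(\mathbb{C})$ with $P = P^2 = P^*$, and $P\mathcal{V}P = \{PAP : A \in \mathcal{V}\}$. A quantum $k$-clique for $\mathcal{V}$ is a rank $k$ orthogonal projection $P \in M_n(\mathbb{C})$ with $\dim(P\mathcal{V}P) = k^2$. Dimensions are over $\mathbb{C}$. *)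

theory Defs
  imports "HOL-Analysis.Analysis"
begin

text \<open>
  The type of complex square matrices comes with real scalar multiplication only. Complex
  subspaces and complex dimension are those of the following vector space over the field of
  complex numbers; the unprefixed constants subspace and dim would be the real ones.
\<close>

definition cmat_scale :: "complex \<Rightarrow> complex^'n^'m \<Rightarrow> complex^'n^'m"
  where "cmat_scale c A = (\<chi> i j. c * A $ i $ j)"

interpretation cmat: vector_space cmat_scale
  by unfold_locales (simp_all add: cmat_scale_def vec_eq_iff algebra_simps)

definition hermitian_transpose :: "complex^'n^'m \<Rightarrow> complex^'m^'n"
  where "hermitian_transpose A = map_matrix cnj (transpose A)"

definition operator_system :: "(complex^'n^'n) set \<Rightarrow> bool"
  where "operator_system V \<longleftrightarrow>
    cmat.subspace V \<and> mat 1 \<in> V \<and> (\<forall>A\<in>V. hermitian_transpose A \<in> V)"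

definition orthogonal_projection :: "complex^'n^'n \<Rightarrow> bool"
  where "orthogonal_projection P \<longleftrightarrow> P ** P = P \<and> hermitian_transpose P = P"

definition compression :: "complex^'n^'n \<Rightarrow> (complex^'n^'n) set \<Rightarrow> (complex^'n^'n) set"
  where "compression P V = {P ** A ** P | A. A \<in> V}"

definition quantum_clique :: "nat \<Rightarrow> (complex^'n^'n) set \<Rightarrow> complex^'n^'n \<Rightarrow> bool"
  where "quantum_clique k V P \<longleftrightarrow>
    orthogonal_projection P \<and> rank P = k \<and> cmat.dim (compression P V) = k\<^sup>2"

end

theory Submission
  imports Defs
begin

text \<open>
  Read a matrix in \<open>V\<close> as a bilinear form, and order the positions \<open>(s, t)\<close> lexicographically by
  integer weights of the form \<open>m * p s + p t\<close>. Gaussian elimination shows that at least \<open>dim V\<close>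
  positions are leading positions of elements of \<open>V\<close>, so \<open>k\<^sup>2\<close> of them lie in pairwise distinct rows
  and columns. Label these by pairs \<open>(i, j)\<close>. Let \<open>u i\<close> be the sum of the unit vectors of the rows
  labelled \<open>(i, _)\<close> and \<open>v j\<close> that of the columns labelled \<open>(_, j)\<close>, scaled by powers \<open>T ^ weight\<close>. As
  \<open>T\<close> tends to infinity only the leading entries survive, and the \<open>k\<^sup>2 \<times> k\<^sup>2\<close> matrix of the
  values of the chosen forms on the pairs \<open>(u i, v j)\<close> tends, after rescaling, to the identity.

  Its determinant is therefore a nonzero polynomial in the coordinates of \<open>u\<close> and \<open>v\<close>, and so does not
  vanish on all conjugate pairs \<open>(w, cnj w)\<close>. The projection onto the span of such \<open>w 0, \<dots>, w (k - 1)\<close>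
  (up to conjugation) is a clique.
\<close>

section \<open>Independent families and matchings\<close>

text \<open>Independence of a set does not see repetitions in a family, so injectivity comes as a
  separate conclusion; together they make the size of \<open>I\<close> the size of an independent
  set.\<close>

lemma (in vector_space) independent_family:
  assumes "finite I"
    and zero: "\<And>c. (\<Sum>i\<in>I. scale (c i) (f i)) = 0 \<Longrightarrow> \<forall>i\<in>I. c i = 0"
  shows "inj_on f I" and "independent (f ` I)"
proof -
  show inj: "inj_on f I"
  proof (rule inj_onI, rule ccontr)
    fix i j assume ij: "i \<in> I" "j \<in> I" "f i = f j" "i \<noteq> j"
    define c where "c = (\<lambda>l. if l = i then 1 else if l = j then -1 else (0::'a))"
    have "(\<Sum>l\<in>I. scale (c l) (f l)) = (\<Sum>l\<in>{i,j}. scale (c l) (f l))"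
      using ij assms(1) by (intro sum.mono_neutral_right) (auto simp: c_def)
    also have "\<dots> = 0"
      using ij by (simp add: c_def)
    finally have "c i = 0"
      using zero ij(1) by blast
    then show False
      by (simp add: c_def)
  qed
  show "independent (f ` I)"
  proof
    assume "dependent (f ` I)"
    then obtain u v where uv: "v \<in> f ` I" "u v \<noteq> 0" "(\<Sum>v\<in>f ` I. scale (u v) v) = 0"
      using assms(1) by (auto simp: dependent_finite)
    have "(\<Sum>i\<in>I. scale (u (f i)) (f i)) = 0"
      using uv(3) inj by (simp add: sum.reindex)
    then show False
      using zero[of "u \<circ> f"] uv by auto
  qed
qed

text \<open>A maximal partial matching of size \<open>m\<close> meets at most \<open>2 * m * CARD('n)\<close> positions.\<close>

lemma exists_matching:
  fixes S :: "('n::finite \<times> 'n) set"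
  assumes "2 * m * CARD('n) \<le> card S"
  shows "\<exists>N\<subseteq>S. card N = m \<and> inj_on fst N \<and> inj_on snd N"
  using assms
proof (induction m)
  case 0
  then show ?case by (intro exI[of _ "{}"]) auto
next
  case (Suc m)
  then obtain N where N: "N \<subseteq> S" "card N = m" "inj_on fst N" "inj_on snd N"
    by auto
  define X where "X = (fst ` N) \<times> UNIV \<union> UNIV \<times> (snd ` N)"
  have "card X \<le> card ((fst ` N) \<times> (UNIV::'n set)) + card ((UNIV::'n set) \<times> (snd ` N))"
    unfolding X_def by (rule card_Un_le)
  also have "\<dots> = 2 * m * CARD('n)"
    using N by (simp add: card_cartesian_product card_image)
  also have "\<dots> < card S"
    using Suc.prems by (simp add: algebra_simps) (use zero_less_card_finite[where 'a='n] in linarith)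
  finally have "\<not> S \<subseteq> X"
    by (meson card_mono finite leD)
  then obtain x where x: "x \<in> S" "x \<notin> X" by blast
  then have "fst x \<notin> fst ` N" "snd x \<notin> snd ` N"
    unfolding X_def by (cases x; force)+
  moreover from this have "x \<notin> N" by blast
  ultimately have "insert x N \<subseteq> S \<and> card (insert x N) = Suc m
      \<and> inj_on fst (insert x N) \<and> inj_on snd (insert x N)"
    using N x by auto
  then show ?case by blast
qed

section \<open>Leading positions and Gaussian elimination\<close>

definition leading_at :: "('n \<Rightarrow> 'n \<Rightarrow> nat) \<Rightarrow> 'c::zero^'n^'n \<Rightarrow> 'n \<Rightarrow> 'n \<Rightarrow> bool"
  where "leading_at \<omega> A s t \<longleftrightarrow>
    A $ s $ t \<noteq> 0 \<and> (\<forall>s' t'. A $ s' $ t' \<noteq> 0 \<longrightarrow> \<omega> s' t' \<le> \<omega> s t)"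

lemma exists_leading_at:
  fixes A :: "'c::zero^'n^'n"
  assumes "A \<noteq> 0"
  shows "\<exists>s t. leading_at \<omega> A s t"
proof -
  define X where "X = {(s, t). A $ s $ t \<noteq> 0}"
  have "X \<noteq> {}"
    using assms by (auto simp: X_def vec_eq_iff)
  then have "Max (case_prod \<omega> ` X) \<in> case_prod \<omega> ` X"
    by (intro Max_in) auto
  then obtain s t where st: "(s, t) \<in> X" "Max (case_prod \<omega> ` X) = \<omega> s t"
    by auto
  have "\<omega> s' t' \<le> \<omega> s t" if "(s', t') \<in> X" for s' t'
    unfolding st(2)[symmetric] using that by (intro Max_ge) (auto intro: rev_image_eqI)
  then show ?thesis
    using st(1) unfolding leading_at_def X_def by blast
qed

text \<open>Gaussian elimination: pick one \<open>B x\<close> in \<open>V\<close> for each leading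
  position \<open>x\<close>. Subtracting a multiple of the right \<open>B x\<close> from an element
  of \<open>V\<close> kills its leading entry and leaves only entries of lower weight, so these
  matrices span \<open>V\<close>.\<close>

lemma dim_le_card_leading:
  fixes V :: "(complex^'n^'n) set" and \<omega> :: "'n \<Rightarrow> 'n \<Rightarrow> nat"
  assumes V: "cmat.subspace V"
    and inj: "inj (case_prod \<omega>)"
  shows "cmat.dim V \<le> card {(s, t). \<exists>A\<in>V. leading_at \<omega> A s t}"
proof -
  define S where "S = {(s, t). \<exists>A\<in>V. leading_at \<omega> A s t}"
  have "\<forall>x\<in>S. \<exists>A. A \<in> V \<and> leading_at \<omega> A (fst x) (snd x)"
    by (auto simp: S_def)
  then obtain B where B: "\<And>x. x \<in> S \<Longrightarrow> B x \<in> V \<and> leading_at \<omega> (B x) (fst x) (snd x)"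
    by metis
  \<comment> \<open>Induction on a strict bound \<open>N\<close> for the weights of the nonzero
    entries; the bound 0 leaves only the zero matrix.\<close>
  have small: "A \<in> cmat.span (B ` S)"
    if "A \<in> V" "\<And>s t. A $ s $ t \<noteq> 0 \<Longrightarrow> \<omega> s t < N" for A N
    using that
  proof (induction N arbitrary: A)
    case 0
    then have "A = 0" by (auto simp: vec_eq_iff)
    then show ?case by (simp add: cmat.span_zero)
  next
    case (Suc N)
    show ?case
    proof (cases "\<exists>s t. A $ s $ t \<noteq> 0 \<and> \<omega> s t = N")
      case False
      then show ?thesis
        using Suc.IH[of A] Suc.prems by (metis less_SucE)
    next
      case True
      then obtain s t where st: "A $ s $ t \<noteq> 0" "\<omega> s t = N" by blast
      have "leading_at \<omega> A s t"
        unfolding leading_at_def using st Suc.prems(2) by (auto simp: less_Suc_eq_le)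
      then have "(s, t) \<in> S"
        using Suc.prems(1) by (auto simp: S_def)
      note Bst = B[OF this, simplified]
      define c where "c = A $ s $ t / B (s, t) $ s $ t"
      define A' where "A' = A - cmat_scale c (B (s, t))"
      have "A' \<in> V"
        unfolding A'_def using V Bst Suc.prems(1) by (intro cmat.subspace_diff cmat.subspace_scale) auto
      moreover have "\<omega> s' t' < N" if nz: "A' $ s' $ t' \<noteq> 0" for s' t'
      proof -
        have "A $ s' $ t' \<noteq> 0 \<or> B (s, t) $ s' $ t' \<noteq> 0"
          using nz by (auto simp: A'_def cmat_scale_def)
        then have "\<omega> s' t' \<le> N"
          using Suc.prems(2) Bst st(2) by (auto simp: leading_at_def less_Suc_eq_le)
        \<comment> \<open>Injectivity of the weight leaves \<open>(s, t)\<close> as the only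
          position of weight \<open>N\<close>, and \<open>c\<close> was chosen to cancel the entry
          there.\<close>
        moreover have "\<omega> s' t' \<noteq> N"
        proof
          assume "\<omega> s' t' = N"
          then have "(s', t') = (s, t)"
            using inj st(2) by (auto dest!: injD[of _ "(s', t')" "(s, t)"])
          then show False
            using nz Bst by (simp add: A'_def cmat_scale_def c_def leading_at_def)
        qed
        ultimately show ?thesis by simp
      qed
      ultimately have "A' \<in> cmat.span (B ` S)"
        by (rule Suc.IH)
      moreover have "cmat_scale c (B (s, t)) \<in> cmat.span (B ` S)"
        using \<open>(s, t) \<in> S\<close> by (intro cmat.span_scale cmat.span_base) auto
      moreover have "A = A' + cmat_scale c (B (s, t))"
        by (simp add: A'_def)
      ultimately show ?thesis
        using cmat.span_add by metis
    qed
  qed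
  have "V \<subseteq> cmat.span (B ` S)"
  proof
    fix A assume "A \<in> V"
    have "\<omega> s t < Suc (Max (range (case_prod \<omega>)))" for s t
      by (intro le_imp_less_Suc Max_ge) (auto intro: range_eqI[of _ _ "(s, t)"])
    then show "A \<in> cmat.span (B ` S)"
      using small[OF \<open>A \<in> V\<close>] by blast
  qed
  then have "cmat.dim V \<le> card (B ` S)"
    by (intro cmat.dim_le_card) auto
  also have "\<dots> \<le> card S"
    by (intro card_image_le) auto
  finally show ?thesis
    by (simp add: S_def)
qed

section \<open>Pairings and the limit of the pairing matrix\<close>

definition pairing :: "'a::comm_ring_1^'n^'n \<Rightarrow> 'a^'n \<Rightarrow> 'a^'n \<Rightarrow> 'a"
  where "pairing A u v = (\<Sum>s\<in>UNIV. \<Sum>t\<in>UNIV. u $ s * A $ s $ t * v $ t)"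

definition cnj_vec :: "complex^'n \<Rightarrow> complex^'n"
  where "cnj_vec v = (\<chi> i. cnj (v $ i))"

text \<open>
  The \<open>k\<^sup>2 \<times> k\<^sup>2\<close> matrix of values of the pairings. Its rows and columns are indexed by a subset
  \<open>R\<close> of the type \<open>'n\<close>, with \<open>h\<close> identifying \<open>R\<close> with pairs of indices below \<open>k\<close>, and it is padded
  by the identity outside \<open>R\<close>; so \<open>det\<close> is available for it.
\<close>

definition pairing_matrix ::
  "'n set \<Rightarrow> ('n \<Rightarrow> nat \<times> nat) \<Rightarrow> ('n \<Rightarrow> 'a::comm_ring_1^'n^'n) \<Rightarrow> (nat \<Rightarrow> 'a^'n) \<Rightarrow> (nat \<Rightarrow> 'a^'n) \<Rightarrow> 'a^'n^'n"
  where "pairing_matrix R h A u v = (\<chi> a b.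
    if a \<in> R \<and> b \<in> R then pairing (A a) (u (fst (h b))) (v (snd (h b)))
    else if a = b then 1 else 0)"

lemma tendsto_det:
  fixes M :: "'b \<Rightarrow> complex^'n^'n"
  assumes "\<And>a b. ((\<lambda>x. M x $ a $ b) \<longlongrightarrow> L $ a $ b) F"
  shows "((\<lambda>x. det (M x)) \<longlongrightarrow> det L) F"
  unfolding det_def
  by (rule tendsto_sum, rule tendsto_mult[OF tendsto_const], rule tendsto_prod, rule assms)

text \<open>The weight splits into a row term and a column term, so that \<open>T ^ weight\<close>
  can be distributed over \<open>u\<close> and \<open>v\<close>. Every nonzero contribution from a
  position other than the leading one then carries a negative power of \<open>T\<close>.\<close>

lemma exists_nonsingular_pairing:
  fixes V :: "(complex^'n^'n) set" and \<tau> :: "'n \<Rightarrow> 'n" and p :: "'n \<Rightarrow> nat"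
  assumes V: "cmat.subspace V"
    and h: "inj_on h R"
    and \<tau>: "inj_on \<tau> R"
    and inj: "\<And>s t s' t'. m * p s + p t = m * p s' + p t' \<Longrightarrow> s = s' \<and> t = t'"
    and lead: "\<And>a. a \<in> R \<Longrightarrow> \<exists>A\<in>V. leading_at (\<lambda>s t. m * p s + p t) A a (\<tau> a)"
  shows "\<exists>A u v. (\<forall>a\<in>R. A a \<in> V) \<and> det (pairing_matrix R h A u v) \<noteq> 0"
proof -
  define \<omega> where "\<omega> = (\<lambda>s t. m * p s + p t)"
  obtain B where B: "\<And>a. a \<in> R \<Longrightarrow> B a \<in> V \<and> leading_at \<omega> (B a) a (\<tau> a)"
    using lead unfolding \<omega>_def by metis
  \<comment> \<open>The scaling makes the leading entry contribute exactly 1 as soon as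
    \<open>T > 0\<close>.\<close>
  define A where "A = (\<lambda>(T::nat) a.
    cmat_scale (1 / (B a $ a $ \<tau> a * of_nat T ^ \<omega> a (\<tau> a))) (B a))"
  define u where "u = (\<lambda>(T::nat) (i::nat). \<chi> s.
    if s \<in> R \<and> fst (h s) = i then of_nat T ^ (m * p s) else (0::complex))"
  define v where "v = (\<lambda>(T::nat) (j::nat). \<chi> t.
    if \<exists>a\<in>R. \<tau> a = t \<and> snd (h a) = j then of_nat T ^ p t else (0::complex))"
  have entry: "(\<lambda>T. u T (fst (h b)) $ s * A T a $ s $ t * v T (snd (h b)) $ t)
      \<longlonglongrightarrow> (if a = b \<and> s = a \<and> t = \<tau> a then 1 else 0)"
    if a: "a \<in> R" and b: "b \<in> R" for a b s t
  proof (cases "s \<in> R \<and> fst (h s) = fst (h b) \<and> (\<exists>a\<in>R. \<tau> a = t \<and> snd (h a) = snd (h b))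
      \<and> B a $ s $ t \<noteq> 0")
    case False
    have "\<not> (a = b \<and> s = a \<and> t = \<tau> a)"
      using False a b B[OF a] by (auto simp: leading_at_def)
    moreover have "u T (fst (h b)) $ s * A T a $ s $ t * v T (snd (h b)) $ t = 0" for T
      using False by (auto simp: u_def v_def A_def cmat_scale_def)
    ultimately show ?thesis by (simp only: if_False tendsto_const)
  next
    case True
    define r where "r = B a $ s $ t / B a $ a $ \<tau> a"
    have eq: "u T (fst (h b)) $ s * A T a $ s $ t * v T (snd (h b)) $ t
        = r * (of_nat T ^ \<omega> s t / of_nat T ^ \<omega> a (\<tau> a))" for T
      using True by (simp add: u_def v_def A_def cmat_scale_def r_def \<omega>_def power_add)
    have le: "\<omega> s t \<le> \<omega> a (\<tau> a)"
      using B[OF a] True by (auto simp: leading_at_def)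
    show ?thesis
    proof (cases "s = a \<and> t = \<tau> a")
      case st: True
      \<comment> \<open>At the leading position the nonvanishing factors say that \<open>a\<close>
        and \<open>b\<close> carry the same two labels; injectivity of \<open>\<tau>\<close> is what
        identifies the column label.\<close>
      have "snd (h a) = snd (h b)"
        using True st \<tau> a by (auto dest: inj_onD)
      then have "a = b"
        using True st h a b by (metis inj_onD prod_eqI)
      have "\<forall>\<^sub>F T in sequentially. (1::complex)
          = u T (fst (h b)) $ s * A T a $ s $ t * v T (snd (h b)) $ t"
        \<comment> \<open>At \<open>T = 0\<close> the quotient of powers may be 0 / 0.\<close>
        using eventually_gt_at_top[of 0]
      proof eventually_elim
        case (elim T)
        have "r = 1"
          using B[OF a] st by (auto simp: r_def leading_at_def)
        then show ?case
          unfolding eq using st elim by simp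
      qed
      then show ?thesis
        using st \<open>a = b\<close> by (auto intro: Lim_transform_eventually[OF tendsto_const])
    next
      case False
      then have "\<omega> s t \<noteq> \<omega> a (\<tau> a)"
        using inj unfolding \<omega>_def by blast
      with le have less: "\<omega> s t < \<omega> a (\<tau> a)" by simp
      define d where "d = \<omega> a (\<tau> a) - \<omega> s t"
      have d: "d > 0" "\<omega> a (\<tau> a) = \<omega> s t + d"
        using less by (auto simp: d_def)
      have "(\<lambda>T. r * inverse (of_nat T) ^ d) \<longlonglongrightarrow> r * 0 ^ d"
        by (intro tendsto_intros lim_inverse_n)
      moreover have "\<forall>\<^sub>F T in sequentially. r * inverse (of_nat T) ^ d
          = u T (fst (h b)) $ s * A T a $ s $ t * v T (snd (h b)) $ t"
        using eventually_gt_at_top[of 0]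
        by eventually_elim (simp add: eq d(2) power_add power_inverse divide_inverse)
      ultimately have "(\<lambda>T. u T (fst (h b)) $ s * A T a $ s $ t * v T (snd (h b)) $ t) \<longlonglongrightarrow> r * 0 ^ d"
        by (rule Lim_transform_eventually)
      then show ?thesis
        using False d by (auto simp: zero_power)
    qed
  qed
  have lim: "(\<lambda>T. pairing_matrix R h (A T) (u T) (v T) $ a $ b) \<longlonglongrightarrow> mat 1 $ a $ b" for a b
  proof (cases "a \<in> R \<and> b \<in> R")
    case False
    then show ?thesis
      by (auto simp: pairing_matrix_def mat_def)
  next
    case True
    have "(\<lambda>T. pairing (A T a) (u T (fst (h b))) (v T (snd (h b))))
        \<longlonglongrightarrow> (\<Sum>s\<in>UNIV. \<Sum>t\<in>UNIV. if a = b \<and> s = a \<and> t = \<tau> a then 1 else 0)"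
      unfolding pairing_def using True by (intro tendsto_sum entry) auto
    also have "(\<Sum>s\<in>UNIV. \<Sum>t\<in>UNIV. if a = b \<and> s = a \<and> t = \<tau> a then 1 else 0)
        = (\<Sum>s\<in>UNIV. if s = a then \<Sum>t\<in>UNIV. if t = \<tau> a then if a = b then 1 else 0 else 0 else (0::complex))"
      by (intro sum.cong) auto
    also have "\<dots> = mat 1 $ a $ b"
      by (simp add: mat_def)
    finally show ?thesis
      using True by (simp add: pairing_matrix_def)
  qed
  have "(\<lambda>T. det (pairing_matrix R h (A T) (u T) (v T))) \<longlonglongrightarrow> det (mat 1 :: complex^'n^'n)"
    by (intro tendsto_det lim)
  then have "\<forall>\<^sub>F T in sequentially. det (pairing_matrix R h (A T) (u T) (v T)) \<noteq> 0"
    by (rule tendsto_imp_eventually_ne) simp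
  then obtain T where "det (pairing_matrix R h (A T) (u T) (v T)) \<noteq> 0"
    by (auto simp: eventually_sequentially)
  moreover have "A T a \<in> V" if "a \<in> R" for a
    using B[OF that] V by (auto simp: A_def intro: cmat.subspace_scale)
  ultimately show ?thesis by blast
qed

section \<open>Polynomial dependence and the passage to conjugate pairs\<close>

definition polynomial_map :: "('a::comm_ring_1 \<Rightarrow> 'a) \<Rightarrow> bool"
  where "polynomial_map f \<longleftrightarrow> (\<exists>p. f = poly p)"

lemma polynomial_map_const: "polynomial_map (\<lambda>_. c)"
  unfolding polynomial_map_def by (rule exI[of _ "[:c:]"]) auto

lemma polynomial_map_ident: "polynomial_map (\<lambda>t. t)"
  unfolding polynomial_map_def by (rule exI[of _ "[:0, 1:]"]) auto

lemma polynomial_map_add: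
  assumes "polynomial_map f" "polynomial_map g"
  shows "polynomial_map (\<lambda>t. f t + g t)"
proof -
  obtain p q where "f = poly p" "g = poly q"
    using assms unfolding polynomial_map_def by blast
  then show ?thesis
    unfolding polynomial_map_def by (intro exI[of _ "p + q"]) auto
qed

lemma polynomial_map_mult:
  assumes "polynomial_map f" "polynomial_map g"
  shows "polynomial_map (\<lambda>t. f t * g t)"
proof -
  obtain p q where "f = poly p" "g = poly q"
    using assms unfolding polynomial_map_def by blast
  then show ?thesis
    unfolding polynomial_map_def by (intro exI[of _ "p * q"]) auto
qed

lemma polynomial_map_sum:
  "(\<And>i. i \<in> I \<Longrightarrow> polynomial_map (f i)) \<Longrightarrow> polynomial_map (\<lambda>t. \<Sum>i\<in>I. f i t)"
  by (induction I rule: infinite_finite_induct)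
    (auto intro: polynomial_map_const polynomial_map_add)

lemma polynomial_map_prod:
  "(\<And>i. i \<in> I \<Longrightarrow> polynomial_map (f i)) \<Longrightarrow> polynomial_map (\<lambda>t. \<Prod>i\<in>I. f i t)"
  by (induction I rule: infinite_finite_induct)
    (auto intro: polynomial_map_const polynomial_map_mult)

lemmas polynomial_map_intros = polynomial_map_const polynomial_map_ident polynomial_map_add
  polynomial_map_mult polynomial_map_sum polynomial_map_prod

text \<open>The coordinates are made real one at a time: in each the function is a nonzero
  polynomial with finitely many roots, while there are infinitely many reals. Hence polynomial
  dependence on each variable separately is enough.\<close>

lemma exists_real_nonzero:
  fixes F :: "('i \<Rightarrow> complex) \<Rightarrow> complex"
  assumes "finite I"
    and poly: "\<And>x i. polynomial_map (\<lambda>t. F (x(i := t)))"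
    and nz: "F x \<noteq> 0"
  shows "\<exists>y. F y \<noteq> 0 \<and> (\<forall>i\<in>I. y i \<in> \<real>)"
  using assms(1)
proof (induction I rule: finite_induct)
  case empty
  then show ?case using nz by blast
next
  case (insert i I)
  then obtain y where y: "F y \<noteq> 0" "\<forall>i\<in>I. y i \<in> \<real>" by blast
  obtain p where p: "(\<lambda>t. F (y(i := t))) = poly p"
    using poly unfolding polynomial_map_def by metis
  have "poly p (y i) \<noteq> 0"
    using y(1) fun_cong[OF p, of "y i"] by simp
  then have "finite {t. poly p t = 0}"
    by (intro poly_roots_finite) auto
  moreover have "infinite (\<real> :: complex set)"
    using infinite_UNIV_char_0[where 'a=real] finite_imageD[of of_real "UNIV::real set"]
    unfolding Reals_def by (auto simp: inj_on_def)
  ultimately obtain t where "t \<in> \<real>" "poly p t \<noteq> 0"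
    using finite_subset[of "\<real>" "{t. poly p t = 0}"] by blast
  moreover from this have "F (y(i := t)) \<noteq> 0"
    using fun_cong[OF p, of t] by simp
  moreover have "\<forall>j\<in>insert i I. (y(i := t)) j \<in> \<real>"
    using y(2) \<open>t \<in> \<real>\<close> by simp
  ultimately show ?case by blast
qed

text \<open>
  The pairs \<open>(w, cnj w)\<close> are Zariski dense in the pairs \<open>(u, v)\<close>: they are the image of the real points
  under the linear change of coordinates \<open>u = x + \<i> y\<close>, \<open>v = x - \<i> y\<close>.
\<close>

lemma nonsingular_pairing_cnj:
  fixes A :: "'n \<Rightarrow> complex^'n^'n" and u v :: "nat \<Rightarrow> complex^'n"
  assumes h: "h ` R \<subseteq> {..<k} \<times> {..<k}"
    and det: "det (pairing_matrix R h A u v) \<noteq> 0"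
  shows "\<exists>w. det (pairing_matrix R h A w (\<lambda>i. cnj_vec (w i))) \<noteq> 0"
proof -
  define U where "U = (\<lambda>x (i::nat). \<chi> s::'n. x (i, s, True) + \<i> * x (i, s, False))"
  define W where "W = (\<lambda>x (i::nat). \<chi> s::'n. x (i, s, True) - \<i> * x (i, s, False))"
  define F where "F = (\<lambda>x. det (pairing_matrix R h A (U x) (W x)))"
  \<comment> \<open>The preimage of \<open>(u, v)\<close> under the change of coordinates; its
    entries need not be real.\<close>
  define x where "x = (\<lambda>(i, s, b). if b then (u i $ s + v i $ s) / 2 else (u i $ s - v i $ s) / (2 * \<i>))"
  have "U x = u" "W x = v"
    by (auto simp: U_def W_def x_def fun_eq_iff vec_eq_iff field_simps)
  then have "F x \<noteq> 0"
    using det by (simp add: F_def)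
  moreover have "polynomial_map (\<lambda>t. F (x(c := t)))" for x c
  proof -
    have coord: "polynomial_map (\<lambda>t. (x(c := t)) d)" for d
      by (cases "d = c") (auto intro: polynomial_map_intros)
    have U: "polynomial_map (\<lambda>t. U (x(c := t)) i $ s)" for i s
      unfolding U_def vec_lambda_beta by (intro polynomial_map_intros coord)
    have W: "polynomial_map (\<lambda>t. W (x(c := t)) i $ s)" for i s
    proof -
      \<comment> \<open>The difference is written as a sum with coefficient \<open>- \<i>\<close> to
        fit the closure rules.\<close>
      have "polynomial_map (\<lambda>t. (x(c := t)) (i, s, True) + (- \<i>) * (x(c := t)) (i, s, False))"
        by (intro polynomial_map_intros coord)
      then show ?thesis
        by (simp add: W_def)
    qed
    have "polynomial_map (\<lambda>t. pairing_matrix R h A (U (x(c := t))) (W (x(c := t))) $ a $ b)" for a b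
    proof (cases "a \<in> R \<and> b \<in> R")
      case True
      then show ?thesis
        by (simp add: pairing_matrix_def pairing_def) (intro polynomial_map_intros U W)
    next
      case False
      then show ?thesis
        by (auto simp: pairing_matrix_def intro: polynomial_map_const)
    qed
    then show ?thesis
      unfolding F_def det_def by (intro polynomial_map_intros)
  qed
  moreover have "finite ({..<k} \<times> (UNIV :: ('n \<times> bool) set))"
    by simp
  ultimately obtain y where y: "F y \<noteq> 0" "\<forall>c\<in>{..<k} \<times> (UNIV :: ('n \<times> bool) set). y c \<in> \<real>"
    using exists_real_nonzero[of "{..<k} \<times> UNIV" F x] by blast
  \<comment> \<open>Only the finitely many coordinates with first index below \<open>k\<close> were
    made real; the pairing matrix reads no others.\<close>
  have conj: "W y i = cnj_vec (U y i)" if "i < k" for i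
    using y(2) that by (auto simp: W_def U_def cnj_vec_def vec_eq_iff Reals_cnj_iff)
  have "pairing_matrix R h A (U y) (W y) = pairing_matrix R h A (U y) (\<lambda>i. cnj_vec (U y i))"
  proof -
    have "snd (h b) < k" if "b \<in> R" for b
      using h that by (auto simp: mem_Times_iff)
    then show ?thesis
      by (auto simp: pairing_matrix_def vec_eq_iff conj)
  qed
  then show ?thesis
    using y(1) unfolding F_def by metis
qed

section \<open>Orthogonal projections onto spans\<close>

lemma orthogonal_projection_entry:
  assumes "orthogonal_projection P"
  shows "P $ s $ t = cnj (P $ t $ s)"
proof -
  have "P $ s $ t = hermitian_transpose P $ s $ t"
    using assms by (simp add: orthogonal_projection_def)
  then show ?thesis
    by (simp add: hermitian_transpose_def transpose_def)
qed

text \<open>Gram-Schmidt: the component \<open>q\<close> of \<open>w k\<close> orthogonal to the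
  earlier vectors is either zero, and \<open>P\<close> stays, or contributes the rank one projection
  onto its line. Vectors act as rows, so the span becomes the row space of \<open>P\<close>.\<close>

lemma exists_projection_onto:
  fixes w :: "nat \<Rightarrow> complex^'n"
  shows "\<exists>P. orthogonal_projection P \<and> (\<forall>i<k. w i v* P = w i) \<and> (\<forall>x. x v* P \<in> vec.span (w ` {..<k}))"
proof (induction k)
  case 0
  have "orthogonal_projection (0 :: complex^'n^'n)"
    by (simp add: orthogonal_projection_def hermitian_transpose_def vec_eq_iff transpose_def)
  then show ?case by (intro exI[of _ 0]) auto
next
  case (Suc k)
  then obtain P where P: "orthogonal_projection P" "\<And>i. i < k \<Longrightarrow> w i v* P = w i"
    "\<And>x. x v* P \<in> vec.span (w ` {..<k})"
    by blast
  have mono: "vec.span (w ` {..<k}) \<subseteq> vec.span (w ` {..<Suc k})"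
    by (intro vec.span_mono) auto
  define q where "q = w k - w k v* P"
  have qP: "q v* P = 0"
    using P(1) by (simp add: q_def vector_matrix_mult_diff_distrib vector_matrix_mul_assoc orthogonal_projection_def)
  have q_span: "q \<in> vec.span (w ` {..<Suc k})"
    unfolding q_def by (rule vec.span_diff) (use P(3) mono in \<open>auto intro: vec.span_base\<close>)
  show ?case
  proof (cases "q = 0")
    case True
    then have "w i v* P = w i" if "i < Suc k" for i
      using P(2) that by (auto simp: q_def less_Suc_eq)
    then show ?thesis
      using P(1,3) mono by blast
  next
    case False
    define N where "N = (\<Sum>s\<in>UNIV. q $ s * cnj (q $ s))"
    define ip where "ip = (\<lambda>x. \<Sum>s\<in>UNIV. x $ s * cnj (q $ s))"
    \<comment> \<open>\<open>x v* Q\<close> is the orthogonal projection of the row vector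
      \<open>x\<close> onto the line of \<open>q\<close>.\<close>
    define Q where "Q = (\<chi> s t. cnj (q $ s) * q $ t / N)"
    have N_real: "cnj N = N"
      by (simp add: N_def mult.commute)
    have "N = of_real (\<Sum>s\<in>UNIV. (cmod (q $ s))\<^sup>2)"
      by (simp add: N_def complex_norm_square del: of_real_power)
    moreover have "(\<Sum>s\<in>UNIV. (cmod (q $ s))\<^sup>2) \<noteq> 0"
      using False by (subst sum_nonneg_eq_0_iff) (auto simp: vec_eq_iff)
    ultimately have N: "N \<noteq> 0"
      by (metis of_real_eq_0_iff)
    have Q: "x v* Q = (ip x / N) *s q" for x
      by (simp add: vec_eq_iff vector_matrix_mult_def Q_def ip_def sum_distrib_right sum_divide_distrib mult.assoc)
    note adj = orthogonal_projection_entry[OF P(1)]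
    \<comment> \<open>Self-adjointness moves \<open>P\<close> onto \<open>q\<close>, and
      \<open>q v* P = 0\<close>.\<close>
    have ip_P: "ip (x v* P) = 0" for x
    proof -
      have "ip (x v* P) = (\<Sum>t\<in>UNIV. \<Sum>s\<in>UNIV. x $ s * (P $ s $ t * cnj (q $ t)))"
        by (simp add: ip_def vector_matrix_mult_def sum_distrib_right mult.assoc)
      also have "\<dots> = (\<Sum>s\<in>UNIV. \<Sum>t\<in>UNIV. x $ s * (P $ s $ t * cnj (q $ t)))"
        by (rule sum.swap)
      also have "\<dots> = (\<Sum>s\<in>UNIV. x $ s * cnj ((q v* P) $ s))"
        by (simp add: vector_matrix_mult_def sum_distrib_left adj[symmetric] mult.commute)
      finally show ?thesis
        by (simp add: qP)
    qed
    have ip_q: "ip q = N"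
      by (simp add: ip_def N_def)
    have ip_diff: "ip (x - y) = ip x - ip y" for x y
      by (simp add: ip_def sum_subtractf algebra_simps)
    have ip_scale: "ip (c *s x) = c * ip x" for c x
      by (simp add: ip_def sum_distrib_left mult.assoc)
    have PQ: "x v* (P + Q) = x v* P + (ip x / N) *s q" for x
      by (simp add: vector_matrix_mult_add_rdistrib Q)
    \<comment> \<open>Applying \<open>P + Q\<close> changes neither the \<open>P\<close> part of
      \<open>x\<close> nor its inner product with \<open>q\<close>, and these two determine the
      result.\<close>
    have "(x v* (P + Q)) v* (P + Q) = x v* (P + Q)" for x
    proof -
      have "(x v* P) v* P = x v* P"
        using P(1) by (simp add: vector_matrix_mul_assoc orthogonal_projection_def)
      moreover have "ip (x v* (P + Q)) = ip x"
        using ip_diff[of "x v* (P + Q)" "x v* P"] N ip_q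
        by (simp add: PQ ip_P ip_scale)
      ultimately show ?thesis
        by (simp add: PQ vector_matrix_left_distrib scalar_vector_matrix_assoc qP)
    qed
    then have "(P + Q) ** (P + Q) = P + Q"
      by (metis vector_matrix_mul_assoc transpose_matrix_vector matrix_eq transpose_transpose)
    moreover have "hermitian_transpose (P + Q) = P + Q"
      by (simp add: vec_eq_iff hermitian_transpose_def transpose_def adj[symmetric] Q_def N_real mult.commute)
    ultimately have "orthogonal_projection (P + Q)"
      by (simp add: orthogonal_projection_def)
    moreover have "w i v* (P + Q) = w i" if "i < Suc k" for i
    proof (cases "i = k")
      case True
      have "ip (w k) = N"
        using ip_diff[of "w k" "w k v* P"] ip_q by (simp add: ip_P q_def)
      then show ?thesis
        using N True by (simp add: PQ) (simp add: q_def)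
    next
      case False
      then have "i < k" using that by simp
      then show ?thesis
        using ip_P[of "w i"] by (simp add: PQ P(2))
    qed
    moreover have "x v* (P + Q) \<in> vec.span (w ` {..<Suc k})" for x
      unfolding PQ using P(3) mono q_span by (intro vec.span_add vec.span_scale) auto
    ultimately show ?thesis by blast
  qed
qed

section \<open>Pairings under linear combinations and compressions\<close>

lemma pairing_add:
  "pairing (X + Y) u v = pairing X u v + pairing Y u v"
  "pairing X (u + u') v = pairing X u v + pairing X u' v"
  "pairing X u (v + v') = pairing X u v + pairing X u v'"
  by (simp_all add: pairing_def algebra_simps sum.distrib)

lemma pairing_diff: "pairing (X - Y) u v = pairing X u v - pairing Y u v"
  by (simp add: pairing_def algebra_simps sum_subtractf)

lemma pairing_scale:
  "pairing (cmat_scale c X) u v = c * pairing X u v"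
  "pairing X (c *s u) v = c * pairing X u v"
  "pairing X u (c *s v) = c * pairing X u v"
  by (simp_all add: pairing_def cmat_scale_def sum_distrib_left mult_ac)

lemma pairing_zero [simp]: "pairing 0 u v = 0" "pairing X 0 v = 0" "pairing X u 0 = 0"
  by (simp_all add: pairing_def)

lemma pairing_sum:
  "pairing (\<Sum>a\<in>I. f a) u v = (\<Sum>a\<in>I. pairing (f a) u v)"
  "pairing X (\<Sum>a\<in>I. g a) v = (\<Sum>a\<in>I. pairing X (g a) v)"
  by (induction I rule: infinite_finite_induct) (simp_all add: pairing_add)

text \<open>The expression is linear in \<open>x\<close> and conjugate linear in \<open>y\<close>,
  so one span induction per argument reduces it to the generators.\<close>

lemma pairing_zero_on_span:
  assumes zero: "\<And>i j. i \<in> I \<Longrightarrow> j \<in> I \<Longrightarrow> pairing X (w i) (cnj_vec (w j)) = 0"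
    and x: "x \<in> vec.span (w ` I)" and y: "y \<in> vec.span (w ` I)"
  shows "pairing X x (cnj_vec y) = 0"
proof -
  have cnj_add: "cnj_vec (a + b) = cnj_vec a + cnj_vec b"
    and cnj_scale: "cnj_vec (c *s a) = cnj c *s cnj_vec a"
    and cnj_zero: "cnj_vec 0 = 0" for a b :: "complex^'n" and c
    by (simp_all add: cnj_vec_def vec_eq_iff)
  have "pairing X x (cnj_vec (w j)) = 0" if "j \<in> I" for j
    using x
    by (induction rule: vec.span_induct_alt)
      (auto simp: pairing_add pairing_scale zero that)
  with y show ?thesis
    by (induction rule: vec.span_induct_alt)
      (auto simp: cnj_add cnj_scale cnj_zero pairing_add pairing_scale)
qed

lemma pairing_eq_sum:
  "pairing X u v = (\<Sum>t\<in>UNIV. (u v* X) $ t * v $ t)"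
  "pairing X u v = (\<Sum>s\<in>UNIV. u $ s * (X *v v) $ s)"
proof -
  show "pairing X u v = (\<Sum>s\<in>UNIV. u $ s * (X *v v) $ s)"
    by (simp add: pairing_def matrix_vector_mult_def sum_distrib_left mult.assoc)
  have "(\<Sum>t\<in>UNIV. (u v* X) $ t * v $ t) = (\<Sum>t\<in>UNIV. \<Sum>s\<in>UNIV. u $ s * X $ s $ t * v $ t)"
    by (simp add: vector_matrix_mult_def sum_distrib_right)
  also have "\<dots> = pairing X u v"
    unfolding pairing_def by (rule sum.swap)
  finally show "pairing X u v = (\<Sum>t\<in>UNIV. (u v* X) $ t * v $ t)" ..
qed

text \<open>The left factor acts on \<open>u\<close> directly; the right one passes through
  \<open>cnj_vec\<close> because \<open>P\<close> is self-adjoint.\<close>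

lemma pairing_compression:
  assumes "orthogonal_projection P"
  shows "pairing (P ** X ** P) u (cnj_vec v) = pairing X (u v* P) (cnj_vec (v v* P))"
proof -
  have "P *v cnj_vec v = cnj_vec (v v* P)"
    by (simp add: vec_eq_iff matrix_vector_mult_def vector_matrix_mult_def cnj_vec_def
        orthogonal_projection_entry[OF assms, symmetric] mult.commute)
  then have "pairing (P ** X ** P) u (cnj_vec v) = pairing (P ** X) u (cnj_vec (v v* P))"
    by (simp add: pairing_eq_sum(2) matrix_vector_mul_assoc[symmetric])
  also have "\<dots> = pairing X (u v* P) (cnj_vec (v v* P))"
    by (simp add: pairing_eq_sum(1) vector_matrix_mul_assoc)
  finally show ?thesis .
qed

text \<open>Turns the entries of a compression into values of \<open>X\<close> on projected unit
  vectors, which for the clique lie in the span of the \<open>w i\<close>.\<close>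

lemma compression_entry:
  fixes P :: "complex^'n^'n"
  assumes "orthogonal_projection P"
  shows "(P ** X ** P) $ s $ t = pairing X (axis s 1 v* P) (cnj_vec (axis t 1 v* P))"
proof -
  have "(Z :: complex^'n^'n) $ s $ t = pairing Z (axis s 1) (cnj_vec (axis t 1))" for Z
    by (simp add: pairing_def cnj_vec_def axis_def if_distrib[of "\<lambda>x. x * _"] if_distrib[of "\<lambda>x. _ * x"]
        if_distrib[of cnj] cong: if_cong)
  then show ?thesis
    using pairing_compression[OF assms] by metis
qed


section \<open>From a nonsingular pairing matrix to a clique\<close>

text \<open>Invertibility of the pairing matrix is used three times: independent rows make the
  compressed \<open>A a\<close> independent, rows that span bound the dimension of the compression
  by \<open>k^2\<close>, and a trivial kernel makes the \<open>w i\<close> independent, so that the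
  projection has rank \<open>k\<close>.\<close>

lemma quantum_clique_if_nonsingular_pairing:
  fixes V :: "(complex^'n^'n) set" and A :: "'n \<Rightarrow> complex^'n^'n" and w :: "nat \<Rightarrow> complex^'n"
  assumes V: "cmat.subspace V"
    and h: "bij_betw h R ({..<k} \<times> {..<k})"
    and A: "\<And>a. a \<in> R \<Longrightarrow> A a \<in> V"
    and det: "det (pairing_matrix R h A w (\<lambda>i. cnj_vec (w i))) \<noteq> 0"
  shows "\<exists>P. quantum_clique k V P"
proof -
  define m where "m = (\<lambda>X i j. pairing X (w i) (cnj_vec (w j)))"
  define M where "M = pairing_matrix R h A w (\<lambda>i. cnj_vec (w i))"
  obtain M' where M': "M ** M' = mat 1" "M' ** M = mat 1"
    using det unfolding M_def by (metis invertible_det_nz invertible_def)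
  have hk: "fst (h b) < k" "snd (h b) < k" if "b \<in> R" for b
    using bij_betwE[OF h] that by (auto simp: mem_Times_iff)
  have surj: "\<exists>b\<in>R. h b = (i, j)" if "i < k" "j < k" for i j
    using h that unfolding bij_betw_def by (metis (no_types, lifting) SigmaI imageE lessThan_iff)
  have M_in: "M $ a $ b = m (A a) (fst (h b)) (snd (h b))" if "a \<in> R" "b \<in> R" for a b
    using that by (simp add: M_def pairing_matrix_def m_def)
  have M_out: "M $ a $ b = 0" if "(a \<in> R) \<noteq> (b \<in> R)" for a b
    using that by (auto simp: M_def pairing_matrix_def)
  \<comment> \<open>The padding has no entries linking \<open>R\<close> to its complement, so the
    block on \<open>R\<close> decouples.\<close>
  have rows: "(x v* M) $ b = (\<Sum>a\<in>R. x $ a * m (A a) (fst (h b)) (snd (h b)))" if "b \<in> R" for x b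
  proof -
    have "(x v* M) $ b = (\<Sum>a\<in>R. x $ a * M $ a $ b)"
      unfolding vector_matrix_mult_def vec_lambda_beta
      by (rule sum.mono_neutral_right) (auto simp: M_out that)
    then show ?thesis
      by (simp add: M_in that)
  qed
  have row_independent: "c a = 0"
    if c: "\<And>i j. i < k \<Longrightarrow> j < k \<Longrightarrow> (\<Sum>a\<in>R. c a * m (A a) i j) = 0" and a: "a \<in> R" for c a
  proof -
    define x where "x = (\<chi> a. if a \<in> R then c a else 0)"
    have "(x v* M) $ b = 0" for b
    proof (cases "b \<in> R")
      case True
      then show ?thesis
        using c hk by (simp add: rows x_def)
    next
      case False
      then show ?thesis
        by (auto simp: vector_matrix_mult_def x_def M_out intro: sum.neutral)
    qed
    then have "x v* M = 0"
      by (simp add: vec_eq_iff)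
    then have "x = 0"
      using M'(1) by (metis vector_matrix_mul_assoc vector_matrix_mul_rid vector_matrix_mult_0)
    then have "x $ a = 0" by simp
    then show "c a = 0"
      using a by (simp add: x_def)
  qed
  have row_span: "\<exists>c. \<forall>i<k. \<forall>j<k. (\<Sum>a\<in>R. c a * m (A a) i j) = m X i j" for X
  proof -
    \<comment> \<open>Solving against \<open>M\<close> turns the values \<open>y\<close> of
      \<open>X\<close> into coefficients \<open>y v* M'\<close>.\<close>
    define y where "y = (\<chi> b. m X (fst (h b)) (snd (h b)))"
    have y: "(y v* M') v* M = y"
      using M'(2) by (simp add: vector_matrix_mul_assoc)
    have "(\<Sum>a\<in>R. (y v* M') $ a * m (A a) i j) = m X i j" if ij: "i < k" "j < k" for i j
    proof -
      obtain b where b: "b \<in> R" "h b = (i, j)"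
        using surj[OF ij] by blast
      show ?thesis
        using rows[OF b(1), of "y v* M'"] unfolding y by (simp add: y_def b(2))
    qed
    then show ?thesis by blast
  qed
  have w_independent: "\<forall>i\<in>{..<k}. c i = 0" if c: "(\<Sum>i<k. c i *s w i) = 0" for c
  proof
    fix i assume "i \<in> {..<k}"
    then have i: "i < k" by simp
    \<comment> \<open>The relation among the \<open>w l\<close> is placed at the labels with second
      component \<open>i\<close>; for \<open>a\<close> in \<open>R\<close> the entry of
      \<open>M *v z\<close> is then the pairing of \<open>A a\<close> with that vanishing
      combination and \<open>cnj_vec (w i)\<close>.\<close>
    define z where "z = (\<chi> b. if b \<in> R \<and> snd (h b) = i then c (fst (h b)) else 0)"
    have "(M *v z) $ a = 0" for a
    proof (cases "a \<in> R")
      case True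
      have "(M *v z) $ a = (\<Sum>b\<in>R. M $ a $ b * z $ b)"
        unfolding matrix_vector_mult_def vec_lambda_beta
        by (rule sum.mono_neutral_right) (auto simp: z_def)
      also have "\<dots> = (\<Sum>b\<in>R. (\<lambda>(l, j). if j = i then c l * m (A a) l i else 0) (h b))"
        by (intro sum.cong) (auto simp: z_def M_in True split: prod.split)
      also have "\<dots> = (\<Sum>(l, j)\<in>{..<k} \<times> {..<k}. if j = i then c l * m (A a) l i else 0)"
        by (rule sum.reindex_bij_betw[OF h])
      also have "\<dots> = (\<Sum>l<k. c l * m (A a) l i)"
        using i by (simp add: sum.cartesian_product[symmetric])
      also have "\<dots> = pairing (A a) (\<Sum>l<k. c l *s w l) (cnj_vec (w i))"
        by (simp add: m_def pairing_sum pairing_scale)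
      finally show ?thesis
        by (simp add: c)
    next
      case False
      then show ?thesis
        by (auto simp: matrix_vector_mult_def z_def M_out intro: sum.neutral)
    qed
    then have "M *v z = 0"
      by (simp add: vec_eq_iff)
    then have z: "z = 0"
      using M'(2) by (metis matrix_vector_mul_assoc matrix_vector_mul_lid matrix_vector_mult_0_right)
    obtain b where "b \<in> R" "h b = (i, i)"
      using surj i by blast
    then have "z $ b = c i"
      by (simp add: z_def)
    then show "c i = 0"
      by (simp add: z)
  qed
  note w_basis = vec.independent_family[of "{..<k}" w, OF finite_lessThan w_independent]
  obtain P where P: "orthogonal_projection P" "\<And>i. i < k \<Longrightarrow> w i v* P = w i"
    "\<And>x. x v* P \<in> vec.span (w ` {..<k})"
    using exists_projection_onto[of k w] by metis
  \<comment> \<open>The rows of \<open>P\<close> are the projected unit vectors, and the rank is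
    computed as the dimension of the row space.\<close>
  have "vec.span (rows P) = vec.span (w ` {..<k})"
  proof (rule vec.span_eq[THEN iffD2], intro conjI)
    have "row s P = axis s 1 v* P" for s
      by (simp add: vec_eq_iff row_def vector_matrix_mult_def axis_def if_distrib[of "\<lambda>x. x * _"] cong: if_cong)
    then show "rows P \<subseteq> vec.span (w ` {..<k})"
      using P(3) by (auto simp: rows_def)
    have "w i \<in> vec.span (rows P)" if "i < k" for i
    proof -
      have "w i = (\<Sum>s\<in>UNIV. w i $ s *s row s P)"
        using P(2)[OF that] by (simp add: vec_eq_iff vector_matrix_mult_def row_def)
      also have "\<dots> \<in> vec.span (rows P)"
        by (intro vec.span_sum vec.span_scale vec.span_base) (auto simp: rows_def)
      finally show ?thesis .
    qed
    then show "w ` {..<k} \<subseteq> vec.span (rows P)" by auto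
  qed
  then have "rank P = k"
    using vec.dim_eq_card[of "w ` {..<k}" "rows P"] w_basis
    by (simp add: row_rank_def_gen card_image)
  moreover have "cmat.dim (compression P V) = k\<^sup>2"
  proof (rule cmat.dim_unique)
    define B where "B = (\<lambda>a. P ** A a ** P)"
    show "B ` R \<subseteq> compression P V"
      using A by (auto simp: B_def compression_def)
    have "\<forall>a\<in>R. c a = 0" if c: "(\<Sum>a\<in>R. cmat_scale (c a) (B a)) = 0" for c
    proof -
      have "(\<Sum>a\<in>R. c a * m (A a) i j) = 0" if "i < k" "j < k" for i j
      proof -
        have "(\<Sum>a\<in>R. c a * m (A a) i j) = pairing (\<Sum>a\<in>R. cmat_scale (c a) (B a)) (w i) (cnj_vec (w j))"
          using that by (simp add: m_def B_def pairing_sum pairing_scale pairing_compression P)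
        then show ?thesis
          by (simp add: c)
      qed
      then show ?thesis
        using row_independent by blast
    qed
    note B_basis = cmat.independent_family[of R B, OF finite this]
    show "cmat.independent (B ` R)"
      by (rule B_basis(2))
    show "card (B ` R) = k\<^sup>2"
      using bij_betw_same_card[OF h] B_basis(1)
      by (simp add: card_image card_cartesian_product power2_eq_square)
    show "compression P V \<subseteq> cmat.span (B ` R)"
    proof
      fix Z assume "Z \<in> compression P V"
      then obtain X where X: "Z = P ** X ** P"
        by (auto simp: compression_def)
      obtain c where c: "\<And>i j. i < k \<Longrightarrow> j < k \<Longrightarrow> (\<Sum>a\<in>R. c a * m (A a) i j) = m X i j"
        using row_span by blast
      \<comment> \<open>\<open>Y\<close> vanishes on all pairs of the \<open>w i\<close>, hence on
        their span, so its compression is zero and \<open>Z\<close> is a combination of the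
        \<open>B a\<close>.\<close>
      define Y where "Y = X - (\<Sum>a\<in>R. cmat_scale (c a) (A a))"
      have "pairing Y (w i) (cnj_vec (w j)) = 0" if "i \<in> {..<k}" "j \<in> {..<k}" for i j
        using c that by (simp add: Y_def pairing_diff pairing_scale pairing_sum m_def)
      then have Y: "pairing Y (x v* P) (cnj_vec (y v* P)) = 0" for x y
        using P(3) P(3) by (rule pairing_zero_on_span)
      have scale_entry: "cmat_scale d W $ s $ t = d * W $ s $ t" for d s t and W :: "complex^'n^'n"
        by (simp add: cmat_scale_def)
      have "Z $ s $ t = (\<Sum>a\<in>R. cmat_scale (c a) (B a)) $ s $ t" for s t
        using Y[of "axis s 1" "axis t 1"]
        by (simp add: X Y_def B_def scale_entry compression_entry[OF P(1)]
            pairing_diff pairing_scale pairing_sum)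
      then have "Z = (\<Sum>a\<in>R. cmat_scale (c a) (B a))"
        by (simp add: vec_eq_iff)
      also have "\<dots> \<in> cmat.span (B ` R)"
        by (intro cmat.span_sum cmat.span_scale cmat.span_base) auto
      finally show "Z \<in> cmat.span (B ` R)" .
    qed
  qed
  ultimately show ?thesis
    using P(1) by (auto simp: quantum_clique_def)
qed

section \<open>Choice of weights, matching and labels\<close>

theorem theorem3p7:
  fixes V :: "(complex^'n^'n) set" and k :: nat
  assumes "k \<ge> 1"
    and "operator_system V"
    and "cmat.dim V \<ge> 16 * k ^ 8 * CARD('n)"
  shows "\<exists>P. quantum_clique k V P"
proof -
  have V: "cmat.subspace V"
    using assms(2) by (simp add: operator_system_def)
  obtain p :: "'n \<Rightarrow> nat" where p: "bij_betw p UNIV {0..<CARD('n)}"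
    using ex_bij_betw_finite_nat[of "UNIV :: 'n set"] by auto
  \<comment> \<open>Row and column numbers are the two digits of the weight in base
    \<open>CARD('n)\<close>, which makes it injective.\<close>
  define \<omega> where "\<omega> = (\<lambda>s t. CARD('n) * p s + p t)"
  have p_less: "p s < CARD('n)" for s
    using bij_betwE[OF p] by auto
  have \<omega>_inj: "s = s' \<and> t = t'" if "\<omega> s t = \<omega> s' t'" for s t s' t'
  proof -
    have "\<omega> s t div CARD('n) = p s" "\<omega> s t mod CARD('n) = p t" for s t
      using p_less[of t] by (simp_all add: \<omega>_def)
    then have "p s = p s'" "p t = p t'"
      using that by metis+
    then show ?thesis
      using p by (auto simp: bij_betw_def dest: injD)
  qed
  define S where "S = {(s, t). \<exists>A\<in>V. leading_at \<omega> A s t}"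
  \<comment> \<open>\<open>exists_matching\<close> with \<open>m = k^2\<close> asks for
    \<open>2 * k^2 * CARD('n)\<close> positions.\<close>
  have "2 * k\<^sup>2 \<le> 16 * k ^ 8"
    using assms(1) power_increasing[of 2 8 k] by linarith
  then have "2 * k\<^sup>2 * CARD('n) \<le> 16 * k ^ 8 * CARD('n)"
    by (rule mult_right_mono) simp
  also have "\<dots> \<le> cmat.dim V"
    by (rule assms(3))
  also have "\<dots> \<le> card S"
    unfolding S_def by (rule dim_le_card_leading[OF V]) (auto intro!: injI dest: \<omega>_inj)
  finally obtain N where N: "N \<subseteq> S" "card N = k\<^sup>2" "inj_on fst N" "inj_on snd N"
    using exists_matching by blast
  \<comment> \<open>\<open>N\<close> is read as the graph of an injective map \<open>\<tau>\<close>
    from its rows to its columns.\<close>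
  define R where "R = fst ` N"
  define \<tau> where "\<tau> = snd \<circ> inv_into N fst"
  have N_graph: "(a, \<tau> a) \<in> N" if "a \<in> R" for a
    using that by (metis R_def \<tau>_def comp_apply f_inv_into_f inv_into_into prod.collapse)
  then have "inj_on \<tau> R"
    using N(4) by (intro inj_onI) (metis inj_onD prod.inject snd_conv)
  have "card R = card ({..<k} \<times> {..<k})"
    using N by (simp add: R_def card_image card_cartesian_product power2_eq_square)
  then obtain h where h: "bij_betw h R ({..<k} \<times> {..<k})"
    using finite_same_card_bij[of R "{..<k} \<times> {..<k}"] by auto
  have "\<exists>A u v. (\<forall>a\<in>R. A a \<in> V) \<and> det (pairing_matrix R h A u v) \<noteq> 0"
  proof (rule exists_nonsingular_pairing[OF V])
    show "inj_on h R"
      using h by (rule bij_betw_imp_inj_on)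
    show "inj_on \<tau> R" by fact
    show "\<exists>A\<in>V. leading_at (\<lambda>s t. CARD('n) * p s + p t) A a (\<tau> a)" if "a \<in> R" for a
      using N_graph[OF that] N(1) by (auto simp: S_def \<omega>_def)
    show "s = s' \<and> t = t'" if "CARD('n) * p s + p t = CARD('n) * p s' + p t'" for s t s' t'
      using \<omega>_inj that by (simp add: \<omega>_def)
  qed
  then obtain A u v where A: "\<And>a. a \<in> R \<Longrightarrow> A a \<in> V" "det (pairing_matrix R h A u v) \<noteq> 0"
    by blast
  moreover have "h ` R \<subseteq> {..<k} \<times> {..<k}"
    using h by (simp add: bij_betw_def)
  ultimately obtain w where "det (pairing_matrix R h A w (\<lambda>i. cnj_vec (w i))) \<noteq> 0"
    using nonsingular_pairing_cnj by blast
  then show ?thesis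
    using quantum_clique_if_nonsingular_pairing[OF V h] A(1) by blast
qed

end
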